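(* Let $n,k$ be integers with $n/2<k<n$, suppose spies are unconstrained, and let $K(n,k)=2(n-k)-B(n-k)$. There is an adaptive questioning strategy which, for every consistent assignment of identities and every behaviour of the spies, identifies a knight by question $K(n,k)+1$, determines the identity of Person $1$ by question $K(n,k)+2$, and by question $n$ either identifies a spy or proves that everyone in the room is a knight; moreover, if a spy is known to be present, it identifies a spy by question $n-1$. When $n=7$ and $k=4$ (and a spy is known to be present), there is no questioning strategy that both identifies a knight by question $K(7,4)=4$ and identifies a spy by question $6$.
   Context: There are $n$ people, numbered $1,\dots,n$, each either a knight or a spy; at least $k$ are knights. The only permitted questions have the form "Person $x$, is Person $y$ a spy?" with $x\ne y$, answered "yes" or "no" by Person $x$; questions may be chosen adaptively. Knights always answer truthfully; spies are unconstrained, meaning each spy may answer each question truthfully or falsely as they see fit (adversarially). "Identifies by question $t$" means that after at most $t$ questions the fact is determined with certainty. $B(s)$ denotes the number of $1$s in the binary expansion of $s\in\mathbf{N}$. *)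

theory Defs
  imports Complex_Main
begin

definition binary_ones :: "nat \<Rightarrow> nat" where
  "binary_ones s = card {i. bit s i}"

definition K :: "nat \<Rightarrow> nat \<Rightarrow> nat" where
  "K n k = 2 * (n - k) - binary_ones (n - k)"

(* The pair (x, y) is the question "Person x, is Person y a spy?"; the answer "yes" is True.
   A history lists the questions asked so far with their answers, oldest first. *)
type_synonym question = "nat \<times> nat"
type_synonym history = "(question \<times> bool) list"
type_synonym strategy = "history \<Rightarrow> question"
type_synonym behaviour = "history \<Rightarrow> question \<Rightarrow> bool"

(* A strategy is a total function that never stops asking. Since every claim below concerns
   only what is known after some bounded number of questions, a strategy that stops early is
   covered by continuing it with arbitrary (ignored) questions. *)
definition questioning_strategy :: "nat \<Rightarrow> strategy \<Rightarrow> bool" where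
  "questioning_strategy n \<sigma> \<longleftrightarrow>
     (\<forall>h. case \<sigma> h of (x, y) \<Rightarrow> x \<in> {1..n} \<and> y \<in> {1..n} \<and> x \<noteq> y)"

(* An assignment of identities is represented by its set S of spies. *)
definition assignments :: "nat \<Rightarrow> nat \<Rightarrow> nat set set" where
  "assignments n k = {S. S \<subseteq> {1..n} \<and> k \<le> card ({1..n} - S)}"

definition assignments_with_spy :: "nat \<Rightarrow> nat \<Rightarrow> nat set set" where
  "assignments_with_spy n k = {S \<in> assignments n k. S \<noteq> {}}"

(* The function \<beta> governs all spies jointly; it may depend on S and on the whole history,
   so that spies may conspire and need not repeat an earlier answer. *)
fun answer :: "nat set \<Rightarrow> behaviour \<Rightarrow> history \<Rightarrow> question \<Rightarrow> bool" where
  "answer S \<beta> h (x, y) = (if x \<in> S then \<beta> h (x, y) else y \<in> S)"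

fun transcript :: "strategy \<Rightarrow> nat set \<Rightarrow> behaviour \<Rightarrow> nat \<Rightarrow> history" where
  "transcript \<sigma> S \<beta> 0 = []"
| "transcript \<sigma> S \<beta> (Suc t) =
     (let h = transcript \<sigma> S \<beta> t; q = \<sigma> h in h @ [(q, answer S \<beta> h q)])"

(* W is the set of assignments possible a priori. An assignment remains possible as long as
   every answer given by a person whom it declares a knight is true. *)
definition possible :: "nat set set \<Rightarrow> history \<Rightarrow> nat set set" where
  "possible W h =
     {S \<in> W. \<forall>x y a. ((x, y), a) \<in> set h \<longrightarrow> x \<notin> S \<longrightarrow> (a \<longleftrightarrow> y \<in> S)}"

(* A fact is determined with certainty when it holds in every assignment in P, the set of
   assignments that are still possible. *)
definition knight_identified :: "nat \<Rightarrow> nat set set \<Rightarrow> bool" where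
  "knight_identified n P \<longleftrightarrow> (\<exists>x\<in>{1..n}. \<forall>S\<in>P. x \<notin> S)"

definition spy_identified :: "nat \<Rightarrow> nat set set \<Rightarrow> bool" where
  "spy_identified n P \<longleftrightarrow> (\<exists>x\<in>{1..n}. \<forall>S\<in>P. x \<in> S)"

definition identity_determined :: "nat \<Rightarrow> nat set set \<Rightarrow> bool" where
  "identity_determined x P \<longleftrightarrow> (\<forall>S\<in>P. x \<in> S) \<or> (\<forall>S\<in>P. x \<notin> S)"

definition all_knights_proved :: "nat set set \<Rightarrow> bool" where
  "all_knights_proved P \<longleftrightarrow> (\<forall>S\<in>P. S = {})"

definition by_question ::
    "nat set set \<Rightarrow> strategy \<Rightarrow> nat \<Rightarrow> (nat set set \<Rightarrow> bool) \<Rightarrow> bool" where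
  "by_question W \<sigma> t goal \<longleftrightarrow>
     (\<forall>S\<in>W. \<forall>\<beta>. \<exists>m\<le>t. goal (possible W (transcript \<sigma> S \<beta> m)))"

end

theory Submission
  imports Defs
begin

text \<open>Write \<open>s = n - k\<close>. To find a knight, keep groups of equal size \<open>2\<^sup>j\<close>, each with a leader
  whose being a spy makes the whole group spies, and let one leader ask about another of the same
  size: ``no'' merges the groups, ``yes'' discards two groups that contain at least \<open>2\<^sup>j\<close> spies.
  A decomposition of \<open>2s\<close> into powers of two has at least \<open>B(s)\<close> parts, so this takes at most
  \<open>K(n,k)\<close> questions.

  To find a spy as well, the groups are chains in which everyone vouches for the next person, and
  the last member of a chain asks about the first member of the next one. If nobody is ever
  accused, then each question was about a different person and only the heads of the chains
  remain to be checked, so \<open>n\<close> questions suffice in total. After the first accusation, which may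
  cost one extra question, a spy is known to be among two people, and leaders are compared as
  before. Person 1 is kept as the last member of a largest chain, so that at the end Person 1
  either is the known knight, who is asked about an accused person, or was accused; a single
  further question then settles both Person 1 and a spy. If \<open>s\<close> is a power of two and
  \<open>n = 2s + 1\<close>, this is one question too slow, and a single chain is used, whose head is asked
  about by newcomers and dropped together with its accuser.

  For \<open>n = 7\<close>, \<open>k = 4\<close> the adversary answers ``no'' twice. If at most three people are involved so
  far, it can avoid revealing a knight; otherwise the questions concern two disjoint pairs, and
  every third question either permits this as well, repeats a person already vouched for, which
  is one question too many for finding a spy, or concerns a third disjoint pair.\<close>

section \<open>Binary digit sums\<close>

lemma bits_rec:
  "{i. bit (s::nat) i} = (if odd s then {0} else {}) \<union> Suc ` {i. bit (s div 2) i}"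
proof (rule set_eqI)
  fix i
  show "i \<in> {i. bit s i} \<longleftrightarrow> i \<in> (if odd s then {0} else {}) \<union> Suc ` {i. bit (s div 2) i}"
    by (cases i) (auto simp: bit_0 bit_Suc)
qed

lemma finite_bits: "finite {i. bit (s::nat) i}"
proof (induction s rule: less_induct)
  case (less s)
  show ?case
  proof (cases "s = 0")
    case False
    then show ?thesis using less[of "s div 2"] by (subst bits_rec) auto
  qed simp
qed

lemma binary_ones_0 [simp]: "binary_ones 0 = 0"
  by (simp add: binary_ones_def)

lemma binary_ones_rec: "binary_ones s = s mod 2 + binary_ones (s div 2)"
proof -
  have "card ({0} \<union> Suc ` {i. bit (s div 2) i}) = Suc (card {i. bit (s div 2) i})"
    using finite_bits[of "s div 2"] by (simp add: card_image)
  then show ?thesis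
    unfolding binary_ones_def bits_rec[of s]
    by (auto simp: card_image odd_iff_mod_2_eq_one)
qed

lemma binary_ones_double [simp]: "binary_ones (2 * s) = binary_ones s"
  using binary_ones_rec[of "2 * s"] by simp

lemma binary_ones_Suc: "binary_ones (Suc m) \<le> Suc (binary_ones m)"
proof (induction m rule: less_induct)
  case (less m)
  show ?case
  proof (cases "even m")
    case True
    then show ?thesis
      using binary_ones_rec[of m] binary_ones_rec[of "Suc m"] by simp
  next
    case False
    then have "binary_ones (Suc m) = binary_ones (Suc (m div 2))"
      using binary_ones_rec[of "Suc m"] by (auto elim!: oddE)
    moreover have "m div 2 < m" using False by (cases m) auto
    moreover have "binary_ones m = Suc (binary_ones (m div 2))"
      using False binary_ones_rec[of m] by (simp add: odd_iff_mod_2_eq_one)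
    ultimately show ?thesis using less by fastforce
  qed
qed

lemma binary_ones_add_power: "binary_ones (m + 2 ^ j) \<le> Suc (binary_ones m)"
proof (induction j arbitrary: m)
  case 0
  then show ?case using binary_ones_Suc[of m] by simp
next
  case (Suc j)
  have "(m + 2 ^ Suc j) div 2 = m div 2 + 2 ^ j" "(m + 2 ^ Suc j) mod 2 = m mod 2"
    by auto
  then show ?case
    using binary_ones_rec[of "m + 2 ^ Suc j"] binary_ones_rec[of m] Suc[of "m div 2"]
    by (simp add: add.commute)
qed

text \<open>Each power of two raises the digit sum by at most one. This bounds the number of groups
  from below, hence the number of merging questions from above.\<close>

lemma binary_ones_le_card:
  assumes "finite F" "\<forall>c\<in>F. \<exists>j. w c = (2::nat) ^ j"
  shows "binary_ones (sum w F) \<le> card F"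
  using assms
proof (induction F)
  case (insert c F)
  then obtain j where "w c = 2 ^ j" by auto
  then have "binary_ones (sum w (insert c F)) \<le> Suc (binary_ones (sum w F))"
    using insert.hyps binary_ones_add_power[of "sum w F" j] by (simp add: add.commute)
  then show ?case using insert by auto
qed simp

lemma binary_ones_pos: "0 < s \<Longrightarrow> 0 < binary_ones s"
proof (induction s rule: less_induct)
  case (less s)
  then show ?case using binary_ones_rec[of s] by (cases "even s") (auto elim!: evenE simp: odd_iff_mod_2_eq_one)
qed

lemma binary_ones_le: "binary_ones s \<le> s"
proof (induction s)
  case (Suc s)
  then show ?case using binary_ones_Suc[of s] by simp
qed simp

text \<open>The powers up to \<open>2 ^ a\<close> sum to less than \<open>2 ^ Suc a\<close>. So once
  no two groups have equal size, the largest holds more than half of the total.\<close>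

lemma sum_distinct_powers_less:
  assumes fin: "finite F" and pow: "\<forall>c\<in>F. \<exists>j. w c = (2::nat) ^ j" and inj: "inj_on w F"
    and m: "m \<in> F" "\<forall>c\<in>F. w c \<le> w m"
  shows "sum w F < 2 * w m"
proof -
  obtain a where a: "w m = 2 ^ a" using pow m by blast
  have "w ` F \<subseteq> (\<lambda>i. 2 ^ i) ` {..<Suc a}"
  proof
    fix v assume "v \<in> w ` F"
    then obtain c where c: "c \<in> F" "v = w c" by auto
    then obtain j where j: "w c = 2 ^ j" using pow by blast
    then have "(2::nat) ^ j \<le> 2 ^ a" using c m a by metis
    then have "j < Suc a" by (simp add: less_Suc_eq_le)
    then show "v \<in> (\<lambda>i. 2 ^ i) ` {..<Suc a}" using c j by blast
  qed
  moreover have "sum w F = \<Sum>(w ` F)" using inj by (simp add: sum.reindex)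
  ultimately have "sum w F \<le> \<Sum>((\<lambda>i. 2 ^ i) ` {..<Suc a})"
    by (simp add: sum_mono2)
  also have "\<dots> = (\<Sum>i<Suc a. 2 ^ i)"
    by (subst sum.reindex) (auto simp: inj_on_def)
  also have "\<dots> < 2 ^ Suc a"
    by (induction a) auto
  finally show ?thesis using a by simp
qed

lemma power_2_less_double:
  assumes "x = (2::nat) ^ i" "y = 2 ^ j" "x < y"
  shows "2 * x \<le> y"
proof -
  have "Suc i \<le> j" using assms by simp
  then have "(2::nat) ^ Suc i \<le> 2 ^ j" by (rule power_increasing) simp
  then show ?thesis using assms by simp
qed

section \<open>Knowledge and strategies\<close>

definition refine :: "nat set set \<Rightarrow> question \<Rightarrow> bool \<Rightarrow> nat set set" where
  "refine P q a = {S \<in> P. fst q \<notin> S \<longrightarrow> (a \<longleftrightarrow> snd q \<in> S)}"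

lemma refine_subset: "refine P q a \<subseteq> P"
  by (auto simp: refine_def)

lemma possible_Nil [simp]: "possible W [] = W"
  by (simp add: possible_def)

lemma possible_snoc: "possible W (h @ [(q, a)]) = refine (possible W h) q a"
  by (cases q) (fastforce simp: possible_def refine_def)

lemma possible_append_subset: "possible W (h @ h') \<subseteq> possible W h"
  by (auto simp: possible_def)

lemma knight_identified_mono: "knight_identified n P \<Longrightarrow> P' \<subseteq> P \<Longrightarrow> knight_identified n P'"
  by (auto simp: knight_identified_def)

lemma spy_identified_mono: "spy_identified n P \<Longrightarrow> P' \<subseteq> P \<Longrightarrow> spy_identified n P'"
  by (auto simp: spy_identified_def)

lemma identity_determined_mono:
  "identity_determined x P \<Longrightarrow> P' \<subseteq> P \<Longrightarrow> identity_determined x P'"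
  by (auto simp: identity_determined_def)

definition legal :: "nat \<Rightarrow> question \<Rightarrow> bool" where
  "legal n q \<longleftrightarrow> fst q \<in> {1..n} \<and> snd q \<in> {1..n} \<and> fst q \<noteq> snd q"

lemma questioning_strategy_legal: "questioning_strategy n \<sigma> \<longleftrightarrow> (\<forall>h. legal n (\<sigma> h))"
  by (simp add: questioning_strategy_def legal_def case_prod_beta conj_assoc)

lemma length_transcript [simp]: "length (transcript \<sigma> S \<beta> m) = m"
  by (induction m) (auto simp: Let_def)

text \<open>Game trees: at time \<open>t\<close> the interrogator knows that the set of spies lies in \<open>P\<close>, and
  every position reached must satisfy \<open>goal\<close>.\<close>

inductive wins :: "nat \<Rightarrow> (nat \<Rightarrow> nat set set \<Rightarrow> bool) \<Rightarrow> nat \<Rightarrow> nat set set \<Rightarrow> bool"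
  for n goal where
  stop: "(\<And>t' P'. t \<le> t' \<Longrightarrow> P' \<subseteq> P \<Longrightarrow> goal t' P') \<Longrightarrow> wins n goal t P"
| ask: "goal t P \<Longrightarrow> legal n q \<Longrightarrow> (\<And>a. wins n goal (Suc t) (refine P q a)) \<Longrightarrow> wins n goal t P"

lemma wins_goal: "wins n goal t P \<Longrightarrow> goal t P"
  by (erule wins.cases) auto

text \<open>A position depends only on \<open>possible W h\<close> and the length of
  \<open>h\<close>, so a good question can be chosen for each history separately. Induction along
  the transcript then shows that play stays in winning positions.\<close>

lemma wins_strategy:
  assumes "wins n goal 0 W" and n: "2 \<le> n"
  obtains \<sigma> where "questioning_strategy n \<sigma>"
    and "\<And>S \<beta> m. goal m (possible W (transcript \<sigma> S \<beta> m))"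
proof -
  define good where "good h q \<longleftrightarrow> legal n q \<and>
    (wins n goal (length h) (possible W h) \<longrightarrow>
      (\<forall>a. wins n goal (Suc (length h)) (refine (possible W h) q a)))" for h q
  have "\<exists>q. good h q" for h
  proof (cases "wins n goal (length h) (possible W h)")
    case True
    then show ?thesis
    proof cases
      case stop
      have "wins n goal (Suc (length h)) (refine (possible W h) (1, 2) a)" for a
        by (rule wins.stop) (meson Suc_leD dual_order.trans refine_subset stop)
      then show ?thesis using n by (intro exI[of _ "(1, 2)"]) (auto simp: good_def legal_def)
    next
      case (ask q)
      then show ?thesis by (intro exI[of _ q]) (simp add: good_def)
    qed
  next
    case False
    then show ?thesis using n by (intro exI[of _ "(1, 2)"]) (auto simp: good_def legal_def)
  qed
  then obtain \<sigma> where \<sigma>: "\<And>h. good h (\<sigma> h)" by metis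
  have "wins n goal m (possible W (transcript \<sigma> S \<beta> m))" for S \<beta> m
  proof (induction m)
    case 0
    then show ?case using assms by simp
  next
    case (Suc m)
    then show ?case
      using \<sigma>[of "transcript \<sigma> S \<beta> m"] by (simp add: Let_def possible_snoc good_def)
  qed
  then show ?thesis
    using that[of \<sigma>] \<sigma> wins_goal by (simp add: questioning_strategy_legal good_def) blast
qed

section \<open>The questioning strategy\<close>

locale room =
  fixes n s :: nat
  assumes s_pos: "0 < s" and majority: "2 * s < n"
begin

definition \<kappa> :: nat where
  "\<kappa> = 2 * s - binary_ones s"

text \<open>All four deadlines form one goal so that a single strategy meets them together. Deleting
  \<open>{}\<close> from \<open>P\<close> expresses the prior knowledge that a spy is present, and
  \<open>n \<le> t + 1\<close> stands for the deadline \<open>n - 1\<close>.\<close>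

definition met :: "nat \<Rightarrow> nat set set \<Rightarrow> bool" where
  "met t P \<longleftrightarrow>
     (\<kappa> + 1 \<le> t \<longrightarrow> knight_identified n P) \<and>
     (\<kappa> + 2 \<le> t \<longrightarrow> identity_determined 1 P) \<and>
     (n \<le> t \<longrightarrow> spy_identified n P \<or> all_knights_proved P) \<and>
     (n \<le> t + 1 \<longrightarrow> spy_identified n (P - {{}}))"

lemma \<kappa>_eq: "\<kappa> + binary_ones s = 2 * s"
  using binary_ones_le[of s] by (simp add: \<kappa>_def)

lemma met_early: "t \<le> \<kappa> \<Longrightarrow> t + 1 < n \<Longrightarrow> met t P"
  by (simp add: met_def)

lemma met_knight: "knight_identified n P \<Longrightarrow> t \<le> \<kappa> + 1 \<Longrightarrow> t + 1 < n \<Longrightarrow> met t P"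
  by (simp add: met_def)

lemma met_knight_identity:
  "knight_identified n P \<Longrightarrow> identity_determined 1 P \<Longrightarrow> t + 1 < n \<Longrightarrow> met t P"
  by (simp add: met_def)

section \<open>Endgames with a known knight\<close>

lemma wins_done:
  assumes "knight_identified n P" "identity_determined 1 P" "spy_identified n P"
  shows "wins n met t P"
proof (rule wins.stop)
  fix t' P' assume "P' \<subseteq> P"
  then have "knight_identified n P'" "identity_determined 1 P'" "spy_identified n P'"
    "spy_identified n (P' - {{}})"
    using assms knight_identified_mono identity_determined_mono
    by (auto intro: spy_identified_mono)
  then show "met t' P'" by (simp add: met_def)
qed

lemma wins_done_all_knights:
  assumes "P \<subseteq> {{}}"
  shows "wins n met t P"
proof (rule wins.stop)
  fix t' P' assume "P' \<subseteq> P"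
  then have "P' \<subseteq> {{}}" using assms by blast
  moreover have "1 \<in> {1..n}" using majority by auto
  ultimately show "met t' P'"
    unfolding met_def knight_identified_def identity_determined_def all_knights_proved_def
      spy_identified_def by blast
qed

text \<open>The knight \<open>z\<close> is asked about \<open>u\<close>: "yes" exposes
  \<open>u\<close>, "no" exposes \<open>v\<close>. As Person 1 is \<open>z\<close> or
  \<open>u\<close>, the same answer settles Person 1.\<close>

lemma wins_known_knight:
  assumes z: "z \<in> {1..n}" "\<forall>S\<in>P. z \<notin> S"
    and uv: "u \<in> {1..n}" "v \<in> {1..n}" "\<forall>S\<in>P. u \<in> S \<or> v \<in> S"
    and one: "z = 1 \<or> u = 1"
    and t: "t \<le> \<kappa> + 1" "t + 1 < n"
  shows "wins n met t P"
proof (cases "z = u")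
  case True
  show ?thesis
    by (rule wins_done)
      (use z uv one True in \<open>auto simp: knight_identified_def spy_identified_def identity_determined_def\<close>)
next
  case False
  have knight: "knight_identified n P"
    using z by (auto simp: knight_identified_def)
  show ?thesis
  proof (rule wins.ask)
    show "met t P" using knight t by (rule met_knight)
    show "legal n (z, u)" using z uv False by (simp add: legal_def)
    fix a
    show "wins n met (Suc t) (refine P (z, u) a)"
    proof (rule wins_done)
      show "knight_identified n (refine P (z, u) a)"
        using knight refine_subset by (rule knight_identified_mono)
      show "identity_determined 1 (refine P (z, u) a)"
        using z one by (auto simp: identity_determined_def refine_def)
      show "spy_identified n (refine P (z, u) a)"
        using z uv by (cases a) (auto simp: spy_identified_def refine_def)
    qed
  qed
qed

text \<open>Person 1 is asked about the members of \<open>fs\<close> in turn and about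
  \<open>g\<close> last. If a spy is known to be present, clearing all of \<open>fs\<close> already
  exposes \<open>g\<close>, which meets the deadline \<open>n - 1\<close>.\<close>

lemma wins_no_accusation:
  assumes "\<forall>S\<in>P. 1 \<notin> S" "g \<in> {1..n} - {1}" "set fs \<subseteq> {1..n} - {1}"
    and "\<forall>S\<in>P. (\<forall>f\<in>set fs. f \<notin> S) \<longrightarrow> g \<notin> S \<longrightarrow> S = {}"
    and "t + length fs < n"
  shows "wins n met t P"
  using assms
proof (induction fs arbitrary: t P)
  case Nil
  have one: "1 \<in> {1..n}" using majority by auto
  have knight: "knight_identified n P" "identity_determined 1 P"
    using Nil.prems(1) one by (auto simp: knight_identified_def identity_determined_def)
  show ?case
  proof (rule wins.ask)
    have "spy_identified n (P - {{}})"
      using Nil.prems(2,4) by (auto simp: spy_identified_def)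
    then show "met t P" using knight Nil.prems(5) by (simp add: met_def)
    show "legal n (1, g)" using Nil.prems(2) one by (auto simp: legal_def)
    fix a
    show "wins n met (Suc t) (refine P (1, g) a)"
    proof (cases a)
      case True
      show ?thesis
        by (rule wins_done)
          (use knight refine_subset Nil.prems(1,2) True in
            \<open>auto intro: knight_identified_mono identity_determined_mono
              simp: spy_identified_def refine_def\<close>)
    next
      case False
      then show ?thesis
        using Nil.prems(1,4) by (intro wins_done_all_knights) (auto simp: refine_def)
    qed
  qed
next
  case (Cons f fs)
  have one: "1 \<in> {1..n}" using majority by auto
  have knight: "knight_identified n P" "identity_determined 1 P"
    using Cons.prems(1) one by (auto simp: knight_identified_def identity_determined_def)
  show ?case
  proof (rule wins.ask)
    show "met t P"
      using knight Cons.prems(5) by (intro met_knight_identity) auto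
    show "legal n (1, f)" using Cons.prems(3) one by (auto simp: legal_def)
    fix a
    show "wins n met (Suc t) (refine P (1, f) a)"
    proof (cases a)
      case True
      show ?thesis
        by (rule wins_done)
          (use knight refine_subset Cons.prems(1,3) True in
            \<open>auto intro: knight_identified_mono identity_determined_mono
              simp: spy_identified_def refine_def\<close>)
    next
      case False
      show ?thesis
        by (rule Cons.IH) (use Cons.prems False in \<open>auto simp: refine_def\<close>)
    qed
  qed
qed

subsection \<open>Merging supporters after an accusation\<close>

text \<open>The weight of a person \<open>c \<in> F\<close> counts people who must all be spies if \<open>c\<close> is one.\<close>

lemma weight_support:
  assumes "finite F" "c \<in> F" "c' \<in> F" "c \<noteq> c'" "w c = (w c' :: nat)" "c' \<in> S \<longrightarrow> c \<in> S"
  shows "sum (w(c' := 2 * w c')) ((F - {c}) \<inter> S) \<le> sum w (F \<inter> S)"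
proof -
  let ?w = "w(c' := 2 * w c')"
  let ?G = "(F - {c, c'}) \<inter> S"
  have G: "finite ?G" "c \<notin> ?G" "c' \<notin> ?G" using assms by auto
  have same: "sum ?w ?G = sum w ?G" by (rule sum.cong) auto
  show ?thesis
  proof (cases "c' \<in> S")
    case True
    then have "(F - {c}) \<inter> S = insert c' ?G" "F \<inter> S = insert c (insert c' ?G)"
      using assms by auto
    then show ?thesis using G same assms by simp
  next
    case False
    then have "(F - {c}) \<inter> S = ?G" using assms by auto
    moreover have "sum w ?G \<le> sum w (F \<inter> S)" using assms by (intro sum_mono2) auto
    ultimately show ?thesis using same by simp
  qed
qed

lemma weight_support_total:
  assumes "finite F" "c \<in> F" "c' \<in> F" "c \<noteq> c'" "w c = (w c' :: nat)"
  shows "sum (w(c' := 2 * w c')) (F - {c}) = sum w F"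
proof -
  let ?G = "F - {c} - {c'}"
  have "sum (w(c' := 2 * w c')) ?G = sum w ?G" by (rule sum.cong) auto
  moreover have "sum (w(c' := 2 * w c')) (F - {c}) = 2 * w c' + sum (w(c' := 2 * w c')) ?G"
    using assms by (subst sum.remove[of _ c']) auto
  moreover have "sum w F = w c + (w c' + sum w ?G)"
    using assms by (simp add: sum.remove[of F c] sum.remove[of "F - {c}" c'])
  ultimately show ?thesis using assms(5) by simp
qed

text \<open>One of the two is a spy. Discarding distinct \<open>c\<close> and \<open>c'\<close> thus
  lowers the spy weight by at least \<open>w c\<close> and the total by \<open>2 * w c\<close>, so a
  total of twice the spy bound stays so.\<close>

lemma weight_accuse:
  assumes "finite F" "c \<in> F" "c' \<in> F" "w c = (w c' :: nat)" "c \<in> S \<or> c' \<in> S"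
  shows "sum w ((F - {c, c'}) \<inter> S) + w c \<le> sum w (F \<inter> S)"
proof -
  obtain d where d: "d \<in> {c, c'}" "d \<in> S" using assms by auto
  have "sum w (insert d ((F - {c, c'}) \<inter> S)) \<le> sum w (F \<inter> S)"
    using assms d by (intro sum_mono2) auto
  moreover have "d \<notin> (F - {c, c'}) \<inter> S" "w d = w c" using assms d by auto
  ultimately show ?thesis using assms by simp
qed

text \<open>Merging \<open>c\<close> into \<open>c'\<close> keeps the weight of Person 1 maximal.\<close>

lemma equal_weights:
  assumes ninj: "\<not> inj_on w F" and pow: "\<forall>c\<in>F. \<exists>j. w c = (2::nat) ^ j"
    and top: "1 \<in> F \<longrightarrow> (\<forall>c\<in>F. w c \<le> w 1)"
  obtains c c' where "c \<in> F" "c' \<in> F" "c \<noteq> c'" "w c = w c'" "c \<noteq> (1::nat)"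
    "1 \<in> F \<longrightarrow> c' = 1 \<or> 2 * w c \<le> w 1"
proof -
  obtain a b where ab: "a \<in> F" "b \<in> F" "a \<noteq> b" "w a = w b" using ninj by (auto simp: inj_on_def)
  define d where "d = (if a = 1 then b else a)"
  define d' where "d' = (if a = 1 then a else b)"
  have d: "d \<in> F" "d' \<in> F" "d \<noteq> d'" "w d = w d'" "d \<noteq> 1"
    using ab by (auto simp: d_def d'_def)
  show ?thesis
  proof (cases "1 \<in> F \<and> w d = w 1")
    case True
    then show ?thesis using that[of d 1] d by auto
  next
    case False
    have "1 \<in> F \<longrightarrow> 2 * w d \<le> w 1"
    proof
      assume "1 \<in> F"
      then have "w d < w 1" using False top d by fastforce
      moreover obtain i where "w d = 2 ^ i" using pow d by blast
      moreover obtain j where "w 1 = 2 ^ j" using pow \<open>1 \<in> F\<close> by blast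
      ultimately show "2 * w d \<le> w 1" by (intro power_2_less_double)
    qed
    then show ?thesis using that[of d d'] d by auto
  qed
qed

lemma distinct_weights_knight:
  assumes fin: "finite F" and pow: "\<forall>c\<in>F. \<exists>j. w c = (2::nat) ^ j" and inj: "inj_on w F"
    and total: "sum w F = 2 * e" and m: "m \<in> F" "\<forall>c\<in>F. w c \<le> w m"
    and S: "sum w (F \<inter> S) \<le> e"
  shows "m \<notin> S"
proof
  assume "m \<in> S"
  then have "w m \<le> sum w (F \<inter> S)" using fin m by (intro member_le_sum) auto
  moreover have "2 * e < 2 * w m" using sum_distinct_powers_less[OF fin pow inj m] total by simp
  ultimately show False using S by simp
qed

text \<open>\<open>e\<close> bounds the remaining spy weight, and the total stays
  \<open>2 * e\<close>. "No" merges two members; "yes" removes two and lowers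
  \<open>binary_ones e\<close> by at most one, so both time bounds persist. The pair
  \<open>u\<close>, \<open>v\<close> contains a spy, and \<open>r\<close> is a reserve who turns out
  to be a knight if \<open>F\<close> runs out.\<close>

lemma wins_accused:
  assumes "finite F" "F \<subseteq> {1..n}" "\<forall>c\<in>F. \<exists>j. w c = 2 ^ j" "sum w F = 2 * e"
    and "r \<in> {1..n}" "\<forall>S\<in>P. sum w (F \<inter> S) + of_bool (r \<in> S) \<le> e"
    and "u \<in> {1..n}" "v \<in> {1..n}" "\<forall>S\<in>P. u \<in> S \<or> v \<in> S"
    and "u = 1 \<or> 1 \<in> F" "1 \<in> F \<longrightarrow> (\<forall>c\<in>F. w c \<le> w 1)"
    and "t + card F \<le> \<kappa> + 1 + binary_ones e" "t + card F + 1 < n + binary_ones e"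
  shows "wins n met t P"
  using assms
proof (induction "card F" arbitrary: F w e t P u v rule: less_induct)
  case less
  note fin = less.prems(1) and range = less.prems(2) and pow = less.prems(3)
    and total = less.prems(4) and bound = less.prems(6) and top = less.prems(11)
  have "binary_ones (sum w F) \<le> card F" using fin pow by (rule binary_ones_le_card)
  then have few: "binary_ones e \<le> card F" using total by simp
  show ?case
  proof (cases "inj_on w F")
    case True
    \<comment> \<open>With distinct weights the heaviest member is a knight, and it is Person 1 if
      Person 1 is in \<open>F\<close>. If \<open>F\<close> is empty, then \<open>e = 0\<close> and
      the knight is \<open>r\<close>.\<close>
    have "\<exists>z\<in>{1..n}. (\<forall>S\<in>P. z \<notin> S) \<and> (z = 1 \<or> u = 1)"
    proof (cases "F = {}")
      case True
      then have "\<forall>S\<in>P. r \<notin> S" using total bound by auto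
      then show ?thesis using less.prems(5,10) True by blast
    next
      case False
      then obtain m where m: "m \<in> F" "\<forall>c\<in>F. w c \<le> w m" "1 \<in> F \<longrightarrow> m = 1"
      proof (cases "1 \<in> F")
        case True
        then show ?thesis using top that by blast
      next
        case no1: False
        have "Max (w ` F) \<in> w ` F" using fin False by auto
        then obtain m where "m \<in> F" "w m = Max (w ` F)" by auto
        then show ?thesis using that[of m] fin no1 by auto
      qed
      have "\<forall>S\<in>P. m \<notin> S"
        using distinct_weights_knight[OF fin pow True total m(1,2)] bound by fastforce
      then show ?thesis using m range less.prems(10) by blast
    qed
    then obtain z where z: "z \<in> {1..n}" "\<forall>S\<in>P. z \<notin> S" "z = 1 \<or> u = 1" by blast
    show ?thesis
      using z(1,2) less.prems(7-9) z(3)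
      by (rule wins_known_knight) (use few less.prems(12,13) in auto)
  next
    case False
    obtain c c' where c: "c \<in> F" "c' \<in> F" "c \<noteq> c'" "w c = w c'" "c \<noteq> 1"
      and c1: "1 \<in> F \<longrightarrow> c' = 1 \<or> 2 * w c \<le> w 1"
      using equal_weights[OF False pow top] .
    let ?w = "w(c' := 2 * w c')"
    obtain i where i: "w c = 2 ^ i" using pow c by blast
    have card: "card (F - {c}) < card F" "card (F - {c, c'}) < card F"
      "card (F - {c}) = card F - 1" "card (F - {c, c'}) = card F - 2" "2 \<le> card F"
    proof -
      have "card {c, c'} \<le> card F" using c fin by (intro card_mono) auto
      then show "2 \<le> card F" using c by simp
      then show "card (F - {c}) < card F" "card (F - {c, c'}) < card F"
        "card (F - {c}) = card F - 1" "card (F - {c, c'}) = card F - 2"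
        using c fin by (auto simp: card_Diff_subset)
    qed
    have pow': "\<forall>d\<in>F - {c}. \<exists>j. ?w d = 2 ^ j"
    proof
      fix d assume "d \<in> F - {c}"
      then show "\<exists>j. ?w d = 2 ^ j"
        using pow i c by (cases "d = c'") (auto intro!: exI[of _ "Suc i"])
    qed
    have total': "sum ?w (F - {c}) = 2 * e"
      using weight_support_total[OF fin c(1-4)] total by simp
    have "binary_ones (sum ?w (F - {c})) \<le> card (F - {c})"
      using fin pow' by (intro binary_ones_le_card) auto
    \<comment> \<open>A merge is still possible, so \<open>card F\<close> exceeds the digit sum and
      no deadline has come yet.\<close>
    then have fewer: "binary_ones e \<le> card F - 1" using total' card by simp
    have two: "w c + w c' \<le> 2 * e"
    proof -
      have "sum w {c, c'} \<le> sum w F" using c fin by (intro sum_mono2) auto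
      then show ?thesis using c total by simp
    qed
    show ?thesis
    proof (rule wins.ask)
      show "met t P"
        using less.prems(12,13) fewer card(5) by (intro met_early) auto
      show "legal n (c, c')" using range c by (auto simp: legal_def)
      fix a
      show "wins n met (Suc t) (refine P (c, c') a)"
      proof (cases a)
        case False
        show ?thesis
        proof (rule less.hyps[OF card(1) _ _ pow' total' less.prems(5) _ less.prems(7,8)])
          show "finite (F - {c})" "F - {c} \<subseteq> {1..n}" using fin range by auto
          show "\<forall>S\<in>refine P (c, c') a. sum ?w ((F - {c}) \<inter> S) + of_bool (r \<in> S) \<le> e"
          proof
            fix S assume "S \<in> refine P (c, c') a"
            then have "S \<in> P" "c' \<in> S \<longrightarrow> c \<in> S" using False by (auto simp: refine_def)
            then show "sum ?w ((F - {c}) \<inter> S) + of_bool (r \<in> S) \<le> e"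
              using weight_support[OF fin c(1-4)] bound by fastforce
          qed
          show "\<forall>S\<in>refine P (c, c') a. u \<in> S \<or> v \<in> S"
            using less.prems(9) by (auto simp: refine_def)
          show "u = 1 \<or> 1 \<in> F - {c}" using less.prems(10) c by auto
          show "1 \<in> F - {c} \<longrightarrow> (\<forall>d\<in>F - {c}. ?w d \<le> ?w 1)"
          proof (intro impI ballI)
            fix d assume "1 \<in> F - {c}" "d \<in> F - {c}"
            then have "w d \<le> w 1" "c' = 1 \<or> 2 * w c \<le> w 1" using top c1 by auto
            then show "?w d \<le> ?w 1" using c(4) by auto
          qed
          show "Suc t + card (F - {c}) \<le> \<kappa> + 1 + binary_ones e"
            "Suc t + card (F - {c}) + 1 < n + binary_ones e"
            using less.prems(12,13) card by auto
        qed
      next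
        case True
        have acc: "S \<in> refine P (c, c') a \<Longrightarrow> S \<in> P \<and> (c \<in> S \<or> c' \<in> S)" for S
          using True by (auto simp: refine_def)
        have e: "w c + (e - w c) = e" using two c by simp
        have drop: "binary_ones e \<le> Suc (binary_ones (e - w c))"
          using binary_ones_add_power[of "e - w c" i] e i by (simp add: add.commute)
        show ?thesis
        \<comment> \<open>If Person 1 is discarded, it is as \<open>c'\<close>, and the fresh
          accusation replaces the old pair. So Person 1 always lies in \<open>F\<close> or equals
          \<open>u\<close>.\<close>
        proof (rule less.hyps[OF card(2), where u = "if c' = 1 then 1 else u"
              and v = "if c' = 1 then c else v"])
          show "finite (F - {c, c'})" "F - {c, c'} \<subseteq> {1..n}"
            "\<forall>d\<in>F - {c, c'}. \<exists>j. w d = 2 ^ j" "r \<in> {1..n}"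
            using fin range pow less.prems(5) by auto
          have "F - {c} - {c'} = F - {c, c'}" by auto
          then have "sum w F = w c + (w c' + sum w (F - {c, c'}))"
            using c fin sum.remove[of F c w] sum.remove[of "F - {c}" c' w] by simp
          then show "sum w (F - {c, c'}) = 2 * (e - w c)" using total c by simp
          show "\<forall>S\<in>refine P (c, c') a. sum w ((F - {c, c'}) \<inter> S) + of_bool (r \<in> S) \<le> e - w c"
          proof
            fix S assume "S \<in> refine P (c, c') a"
            then show "sum w ((F - {c, c'}) \<inter> S) + of_bool (r \<in> S) \<le> e - w c"
              using weight_accuse[OF fin c(1,2,4), of S] acc[of S] bound by fastforce
          qed
          show "(if c' = 1 then 1 else u) \<in> {1..n}" "(if c' = 1 then c else v) \<in> {1..n}"
            using less.prems(7,8) range c by auto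
          show "\<forall>S\<in>refine P (c, c') a.
              (if c' = 1 then 1 else u) \<in> S \<or> (if c' = 1 then c else v) \<in> S"
            using less.prems(9) acc by auto
          show "(if c' = 1 then 1 else u) = 1 \<or> 1 \<in> F - {c, c'}"
            using less.prems(10) c by auto
          show "1 \<in> F - {c, c'} \<longrightarrow> (\<forall>d\<in>F - {c, c'}. w d \<le> w 1)"
            using top by blast
          show "Suc t + card (F - {c, c'}) \<le> \<kappa> + 1 + binary_ones (e - w c)"
            "Suc t + card (F - {c, c'}) + 1 < n + binary_ones (e - w c)"
            using less.prems(12,13) card drop by auto
        qed
      qed
    qed
  qed
qed

end

subsection \<open>Chains of supporters\<close>

text \<open>The relation is transitive, so the pairwise form amounts to everyone vouching for the
  next person. The spies in a chain form an initial segment.\<close>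

definition chain :: "nat set \<Rightarrow> nat list \<Rightarrow> bool" where
  "chain S xs \<longleftrightarrow> sorted_wrt (\<lambda>x y. y \<in> S \<longrightarrow> x \<in> S) xs"

lemma chain_singleton [simp]: "chain S [x]"
  by (simp add: chain_def)

lemma chain_last: "chain S xs \<Longrightarrow> xs \<noteq> [] \<Longrightarrow> last xs \<in> S \<Longrightarrow> set xs \<subseteq> S"
  by (cases xs rule: rev_cases) (auto simp: chain_def sorted_wrt_append)

lemma chain_hd: "chain S xs \<Longrightarrow> hd xs \<notin> S \<Longrightarrow> x \<in> set xs \<Longrightarrow> x \<notin> S"
  by (cases xs) (auto simp: chain_def)

lemma chain_tl: "chain S xs \<Longrightarrow> chain S (tl xs)"
  by (cases xs) (auto simp: chain_def)

lemma chain_append: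
  assumes "chain S xs" "chain S ys" "xs \<noteq> []" "hd ys \<in> S \<longrightarrow> last xs \<in> S"
  shows "chain S (xs @ ys)"
proof -
  have "x \<in> S" if "x \<in> set xs" "y \<in> set ys" "y \<in> S" for x y
    using that assms chain_hd chain_last by blast
  then show ?thesis using assms by (auto simp: chain_def sorted_wrt_append)
qed

lemma hd_neq_last: "distinct xs \<Longrightarrow> 2 \<le> length xs \<Longrightarrow> hd xs \<noteq> last xs"
  by (cases xs) auto

context room
begin

text \<open>Before the first accusation every question joins two chains, whence
  \<open>t + card F = 2 * s\<close>. A chain is indexed by its last member. The final inequality
  leaves room for the accusing question, which does not shrink \<open>F\<close>.\<close>

lemma wins_paths:
  assumes "finite F"
    and "\<forall>c\<in>F. ch c \<noteq> [] \<and> last (ch c) = c \<and> distinct (ch c) \<and> set (ch c) \<subseteq> {1..n} - {r}"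
    and "\<forall>c\<in>F. \<exists>j. length (ch c) = 2 ^ j"
    and "\<forall>c\<in>F. \<forall>d\<in>F. c \<noteq> d \<longrightarrow> set (ch c) \<inter> set (ch d) = {}"
    and "(\<Sum>c\<in>F. length (ch c)) = 2 * s" and "r \<in> {1..n}"
    and "\<forall>S\<in>P. S \<subseteq> {1..n} \<and> card S \<le> s \<and> (\<forall>c\<in>F. chain S (ch c))"
    and "1 \<in> F" "\<forall>c\<in>F. length (ch c) \<le> length (ch 1)"
    and "t + card F = 2 * s" and "2 * s + 2 < n + binary_ones s"
  shows "wins n met t P"
  using assms
proof (induction "card F" arbitrary: F ch t P rule: less_induct)
  case less
  note fin = less.prems(1) and ch = less.prems(2) and pow = less.prems(3)
    and disj = less.prems(4) and total = less.prems(5) and P = less.prems(7)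
    and top = less.prems(8,9)
  let ?w = "\<lambda>c. length (ch c)"
  let ?U = "\<lambda>G. \<Union>c\<in>G. set (ch c)"
  have range: "c \<in> F \<Longrightarrow> set (ch c) \<subseteq> {1..n} - {r}"
    and ends: "c \<in> F \<Longrightarrow> ch c \<noteq> [] \<and> last (ch c) = c" for c
    using ch by blast+
  have in_chain: "c \<in> F \<Longrightarrow> c \<in> set (ch c)" "c \<in> F \<Longrightarrow> hd (ch c) \<in> set (ch c)" for c
    using ends[of c] last_in_set[of "ch c"] by auto
  have disjD: "x \<notin> set (ch d)" if "c \<in> F" "d \<in> F" "c \<noteq> d" "x \<in> set (ch c)" for c d x
    using disj that by blast
  have chainD: "chain S (ch c)" if "S \<in> P" "c \<in> F" for S c
    using P that by blast
  have cardU: "card (?U G) = sum ?w G" if "G \<subseteq> F" for G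
  proof -
    have "card (?U G) = (\<Sum>c\<in>G. card (set (ch c)))"
    proof (rule card_UN_disjoint)
      show "finite G" using that fin by (rule finite_subset)
      show "\<forall>c\<in>G. \<forall>d\<in>G. c \<noteq> d \<longrightarrow> set (ch c) \<inter> set (ch d) = {}" using that disj by blast
    qed simp
    also have "\<dots> = sum ?w G"
    proof (rule sum.cong)
      fix c assume "c \<in> G"
      then have "distinct (ch c)" using that ch by blast
      then show "card (set (ch c)) = ?w c" by (rule distinct_card)
    qed simp
    finally show ?thesis .
  qed
  have U: "?U F \<subseteq> {1..n} - {r}" by (intro UN_least range)
  \<comment> \<open>A spy at the end of a chain makes the whole chain spies. The chains are disjoint
    and avoid \<open>r\<close>, so no spy is counted twice.\<close>
  have bound: "sum ?w (F \<inter> S) + of_bool (r \<in> S) \<le> s" if "S \<in> P" for S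
  proof -
    have S: "finite S" by (rule finite_subset[of _ "{1..n}"]) (use P that in auto)
    have "set (ch c) \<subseteq> S - {r}" if "c \<in> F \<inter> S" for c
    proof -
      have "ch c \<noteq> []" "last (ch c) \<in> S" "chain S (ch c)" "r \<notin> set (ch c)"
        using that ch P \<open>S \<in> P\<close> by auto
      then show ?thesis using chain_last by blast
    qed
    then have "?U (F \<inter> S) \<subseteq> S - {r}" by blast
    then have "card (?U (F \<inter> S)) \<le> card (S - {r})" using S by (intro card_mono) auto
    then have "sum ?w (F \<inter> S) \<le> card (S - {r})" using cardU[of "F \<inter> S"] by simp
    moreover have "card (S - {r}) + of_bool (r \<in> S) = card S"
      using S card_gt_0_iff[of S] by (cases "r \<in> S") auto
    moreover have "card S \<le> s" using P that by blast
    ultimately show ?thesis by linarith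
  qed
  have one: "1 \<in> {1..n}" using majority by simp
  have cardF: "0 < card F" using top fin card_gt_0_iff by blast
  show ?case
  proof (cases "inj_on ?w F")
    case True
    have knight: "\<forall>S\<in>P. 1 \<notin> S"
      using distinct_weights_knight[OF fin pow True total top] bound by fastforce
    have "2 * s < 2 * ?w 1"
      using sum_distinct_powers_less[OF fin pow True top] total by simp
    then have "2 \<le> length (ch 1)" using s_pos by simp
    then have g: "hd (ch 1) \<in> {1..n} - {1}"
      using hd_neq_last[of "ch 1"] ch top(1) in_chain(2)[of 1] by fastforce
    \<comment> \<open>Still to be checked are the heads of the other chains and everyone outside the
      chains. These are at most \<open>card F - 1 + (n - 2 * s)\<close> people, which together with
      \<open>t\<close> stays below \<open>n\<close>.\<close>
    let ?H = "(\<lambda>c. hd (ch c)) ` (F - {1})" and ?R = "{1..n} - ?U F"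
    obtain fs where fs: "set fs = ?H \<union> ?R" "distinct fs"
      using finite_distinct_list[of "?H \<union> ?R"] fin by auto
    have "card ?H \<le> card F - 1"
      using card_image_le[of "F - {1}" "\<lambda>c. hd (ch c)"] fin top(1) by simp
    moreover have "card ?R = n - 2 * s"
      using U cardU[of F] total fin by (subst card_Diff_subset) auto
    moreover have "length fs \<le> card ?H + card ?R"
      using fs distinct_card[of fs] card_Un_le[of ?H ?R] by simp
    ultimately have len: "t + length fs < n" using less.prems(10) cardF majority by linarith
    show ?thesis
    proof (rule wins_no_accusation[OF knight g _ _ len])
      have "?R \<subseteq> {1..n} - {1}" using in_chain(1)[of 1] top(1) by auto
      moreover have "hd (ch c) \<in> {1..n} - {1}" if "c \<in> F - {1}" for c
        using that range[of c] in_chain(2)[of c] in_chain(1)[OF top(1)]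
          disjD[of c 1 "hd (ch c)"] top(1) by auto
      ultimately show "set fs \<subseteq> {1..n} - {1}" using fs by auto
      show "\<forall>S\<in>P. (\<forall>f\<in>set fs. f \<notin> S) \<longrightarrow> hd (ch 1) \<notin> S \<longrightarrow> S = {}"
      proof (intro ballI impI)
        fix S assume S: "S \<in> P" "\<forall>f\<in>set fs. f \<notin> S" "hd (ch 1) \<notin> S"
        have "x \<notin> S" for x
        proof
          assume x: "x \<in> S"
          then have "x \<in> {1..n}" using P S by blast
          then have "x \<in> ?U F" using x S fs by auto
          then obtain c where c: "c \<in> F" "x \<in> set (ch c)" by auto
          then have "hd (ch c) \<notin> S" using S fs by (cases "c = 1") auto
          then show False using chain_hd[OF chainD[OF S(1) c(1)] _ c(2)] x by blast
        qed
        then show "S = {}" by blast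
      qed
    qed
  next
    case False
    obtain c c' where c: "c \<in> F" "c' \<in> F" "c \<noteq> c'" "?w c = ?w c'" "c \<noteq> 1"
      and c1: "1 \<in> F \<longrightarrow> c' = 1 \<or> 2 * ?w c \<le> ?w 1"
      using equal_weights[OF False pow] top by blast
    let ?h = "hd (ch c')"
    let ?ch = "ch(c' := ch c @ ch c')"
    obtain i where i: "?w c = 2 ^ i" using pow c by blast
    have card: "card (F - {c}) = card F - 1" using c fin by simp
    have pow': "\<forall>d\<in>F - {c}. \<exists>j. length (?ch d) = 2 ^ j"
    proof
      fix d assume "d \<in> F - {c}"
      then show "\<exists>j. length (?ch d) = 2 ^ j"
        using pow i c by (cases "d = c'") (auto intro!: exI[of _ "Suc i"])
    qed
    have total': "(\<Sum>d\<in>F - {c}. length (?ch d)) = 2 * s"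
    proof -
      have "(\<Sum>d\<in>F - {c}. length (?ch d)) = sum (?w(c' := 2 * ?w c')) (F - {c})"
        using c by (intro sum.cong) auto
      then show ?thesis using weight_support_total[OF fin c(1-4)] total by simp
    qed
    have "binary_ones (\<Sum>d\<in>F - {c}. length (?ch d)) \<le> card (F - {c})"
      using fin pow' by (intro binary_ones_le_card) auto
    then have fewer: "binary_ones s \<le> card F - 1" using total' card by simp
    have ones: "0 < binary_ones s" using s_pos by (rule binary_ones_pos)
    have h: "?h \<in> {1..n}" "c \<in> {1..n}" "c \<noteq> ?h"
      using range[OF c(1)] range[OF c(2)] in_chain(1)[OF c(1)] in_chain(2)[OF c(2)]
        disjD[OF c(1-3)] by auto
    show ?thesis
    proof (rule wins.ask)
      show "met t P"
        using fewer ones less.prems(10) \<kappa>_eq majority cardF by (intro met_early) linarith+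
      show "legal n (c, ?h)" using h by (simp add: legal_def)
      fix a
      show "wins n met (Suc t) (refine P (c, ?h) a)"
      proof (cases a)
        case False
        show ?thesis
        proof (rule less.hyps[OF _ _ _ pow' _ total' less.prems(6)])
          show "card (F - {c}) < card F" using card cardF by simp
          show "finite (F - {c})" using fin by simp
          show "\<forall>d\<in>F - {c}. ?ch d \<noteq> [] \<and> last (?ch d) = d \<and> distinct (?ch d) \<and>
              set (?ch d) \<subseteq> {1..n} - {r}"
            using ch disj c by auto
          show "\<forall>d\<in>F - {c}. \<forall>d'\<in>F - {c}. d \<noteq> d' \<longrightarrow> set (?ch d) \<inter> set (?ch d') = {}"
            using disj c by auto
          show "\<forall>S\<in>refine P (c, ?h) a. S \<subseteq> {1..n} \<and> card S \<le> s \<and> (\<forall>d\<in>F - {c}. chain S (?ch d))"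
          proof
            fix S assume S: "S \<in> refine P (c, ?h) a"
            have "S \<in> P" "?h \<in> S \<longrightarrow> last (ch c) \<in> S"
              using S False ends[OF c(1)] by (auto simp: refine_def)
            moreover from this have "chain S (ch c @ ch c')"
              using ends[OF c(1)] chainD c by (intro chain_append) auto
            ultimately show "S \<subseteq> {1..n} \<and> card S \<le> s \<and> (\<forall>d\<in>F - {c}. chain S (?ch d))"
              using P by auto
          qed
          show "1 \<in> F - {c}" using top c by auto
          show "\<forall>d\<in>F - {c}. length (?ch d) \<le> length (?ch 1)"
          proof
            fix d assume "d \<in> F - {c}"
            then have "?w d \<le> ?w 1" "c' = 1 \<or> 2 * ?w c \<le> ?w 1" using top c1 by auto
            then show "length (?ch d) \<le> length (?ch 1)" using c(4) by auto
          qed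
          show "Suc t + card (F - {c}) = 2 * s" using less.prems(10) card cardF by simp
          show "2 * s + 2 < n + binary_ones s" by (rule less.prems)
        qed
      next
        case True
        show ?thesis
        proof (rule wins_accused[OF fin _ pow total less.prems(6) _ h(2,1)])
          show "F \<subseteq> {1..n}" using in_chain(1) range by blast
          show "\<forall>S\<in>refine P (c, ?h) a. sum ?w (F \<inter> S) + of_bool (r \<in> S) \<le> s"
            using bound by (simp add: refine_def)
          show "\<forall>S\<in>refine P (c, ?h) a. c \<in> S \<or> ?h \<in> S" using True by (auto simp: refine_def)
          show "c = 1 \<or> 1 \<in> F" "1 \<in> F \<longrightarrow> (\<forall>d\<in>F. ?w d \<le> ?w 1)" using top by auto
          show "Suc t + card F \<le> \<kappa> + 1 + binary_ones s" using less.prems(10) \<kappa>_eq by linarith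
          show "Suc t + card F + 1 < n + binary_ones s" using less.prems(10,11) by linarith
        qed
      qed
    qed
  qed
qed

subsection \<open>A single chain\<close>

text \<open>A newcomer \<open>y\<close> is asked about the head. "No" puts \<open>y\<close> in
  front; "yes" discards both and lowers the spy bound \<open>e\<close> by one. Both answers preserve
  the inequalities on \<open>card N\<close> and \<open>t\<close>, and a chain longer than
  \<open>e\<close> ends in a knight.\<close>

lemma wins_chain_accused:
  assumes "finite N" "N \<subseteq> {1..n}" "set xs \<subseteq> {1..n}" "distinct xs" "set xs \<inter> N = {}"
    and "\<forall>S\<in>P. finite S \<and> chain S xs \<and> card (S \<inter> (set xs \<union> N)) \<le> e"
    and "2 * e < length xs + card N"
    and "u \<in> {1..n}" "v \<in> {1..n}" "\<forall>S\<in>P. u \<in> S \<or> v \<in> S"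
    and "u = 1 \<or> xs \<noteq> [] \<and> last xs = 1"
    and "t + 2 * e < 2 * s + length xs" "t < 2 * s" and "\<kappa> + 1 = 2 * s"
  shows "wins n met t P"
  using assms
proof (induction "card N" arbitrary: N xs e t P u v rule: less_induct)
  case less
  note P = less.prems(6) and uv = less.prems(8-10) and one = less.prems(11)
  have known: "wins n met t P" if "z \<in> {1..n}" "\<forall>S\<in>P. z \<notin> S" "z = 1 \<or> u = 1" for z
    using that(1,2) uv that(3)
    by (rule wins_known_knight) (use less.prems(13,14) majority in auto)
  show ?case
  proof (cases "e < length xs")
    case True
    then have ne: "xs \<noteq> []" by auto
    have "last xs \<notin> S" if S: "S \<in> P" for S
    proof
      assume "last xs \<in> S"
      then have "set xs \<subseteq> S" using chain_last ne P S by blast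
      then have "card (set xs) \<le> card (S \<inter> (set xs \<union> N))" using P S by (intro card_mono) auto
      then show False using True P S distinct_card[OF less.prems(4)] by fastforce
    qed
    then show ?thesis using known[of "last xs"] ne less.prems(3) one last_in_set by blast
  next
    case False
    then have "0 < card N" using less.prems(7) by linarith
    then obtain y where y: "y \<in> N" by fastforce
    have cardN: "card (N - {y}) = card N - 1" "card (N - {y}) < card N"
      using y less.prems(1) \<open>0 < card N\<close> by auto
    show ?thesis
    proof (cases "xs = []")
      case empty: True
      show ?thesis
      proof (cases "e = 0")
        case True
        have "y \<notin> S" if "S \<in> P" for S
          using P that True y empty by fastforce
        then show ?thesis using known[of y] y less.prems(2) one empty by blast
      next
        case False
        \<comment> \<open>An empty chain restarts with \<open>y\<close> without a question; the
          induction still descends because \<open>N\<close> shrinks.\<close>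
        have "insert y (N - {y}) = N" using y by auto
        then show ?thesis
          using less.prems y empty cardN False
          by (intro less.hyps[of "N - {y}" "[y]" _ e u v]) auto
      qed
    next
      case ne: False
      let ?x = "hd xs"
      have x: "?x \<in> set xs" using ne by simp
      have legal: "legal n (y, ?x)" using x y less.prems(2,3,5) by (auto simp: legal_def)
      have early: "t + 1 < 2 * s"
        using less.prems(12) False ne by (cases xs) auto
      show ?thesis
      proof (rule wins.ask[OF _ legal])
        show "met t P" using early less.prems(14) majority by (intro met_early) auto
        fix a
        show "wins n met (Suc t) (refine P (y, ?x) a)"
        proof (cases a)
          case no: False
          show ?thesis
          proof (rule less.hyps[OF cardN(2), of "y # xs" _ e u v])
            show "\<forall>S\<in>refine P (y, ?x) a. finite S \<and> chain S (y # xs) \<and>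
                card (S \<inter> (set (y # xs) \<union> (N - {y}))) \<le> e"
            proof
              fix S assume "S \<in> refine P (y, ?x) a"
              then have S: "S \<in> P" "?x \<in> S \<longrightarrow> y \<in> S" using no by (auto simp: refine_def)
              have "set (y # xs) \<union> (N - {y}) = set xs \<union> N" using y by auto
              moreover have "chain S ([y] @ xs)" using S P by (intro chain_append) auto
              ultimately show "finite S \<and> chain S (y # xs) \<and>
                card (S \<inter> (set (y # xs) \<union> (N - {y}))) \<le> e" using S P by auto
            qed
            show "\<forall>S\<in>refine P (y, ?x) a. u \<in> S \<or> v \<in> S" using uv(3) by (auto simp: refine_def)
            show "u = 1 \<or> y # xs \<noteq> [] \<and> last (y # xs) = 1" using one ne by auto
          qed (use less.prems y cardN early in auto)
        next
          case yes: True
          have acc: "S \<in> refine P (y, ?x) a \<Longrightarrow> S \<in> P \<and> (y \<in> S \<or> ?x \<in> S)" for S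
            using yes by (auto simp: refine_def)
          have lens: "length (tl xs) + 1 = length xs" using ne by (cases xs) auto
          show ?thesis
          \<comment> \<open>If the chain runs out while \<open>u\<close> is not Person 1, then
            \<open>xs\<close> was \<open>[1]\<close>, so the new pair makes Person 1 an accused
            person.\<close>
          proof (rule less.hyps[OF cardN(2), of "tl xs" _ "e - 1"
                "if u \<noteq> 1 \<and> tl xs = [] then ?x else u" "if u \<noteq> 1 \<and> tl xs = [] then y else v"])
            show "set (tl xs) \<subseteq> {1..n}" "set (tl xs) \<inter> (N - {y}) = {}"
              using less.prems(3,5) ne by (auto dest: list.set_sel(2))
            show "\<forall>S\<in>refine P (y, ?x) a. finite S \<and> chain S (tl xs) \<and>
                card (S \<inter> (set (tl xs) \<union> (N - {y}))) \<le> e - 1"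
            proof
              fix S assume "S \<in> refine P (y, ?x) a"
              then have S: "S \<in> P" "y \<in> S \<or> ?x \<in> S" using acc by auto
              have "?x \<notin> set (tl xs)" using less.prems(4) ne by (cases xs) auto
              moreover have "set (tl xs) \<subseteq> set xs" using ne by (auto dest: list.set_sel(2))
              moreover have "y \<notin> set xs" using y less.prems(5) by auto
              ultimately have "S \<inter> (set (tl xs) \<union> (N - {y})) \<subset> S \<inter> (set xs \<union> N)"
                using S(2) x y less.prems(5) by blast
              then have "card (S \<inter> (set (tl xs) \<union> (N - {y}))) < card (S \<inter> (set xs \<union> N))"
                using P S(1) by (intro psubset_card_mono) auto
              moreover have "card (S \<inter> (set xs \<union> N)) \<le> e" using P S(1) by blast
              ultimately have "card (S \<inter> (set (tl xs) \<union> (N - {y}))) \<le> e - 1" by linarith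
              then show "finite S \<and> chain S (tl xs) \<and>
                card (S \<inter> (set (tl xs) \<union> (N - {y}))) \<le> e - 1"
                using P S(1) chain_tl by blast
            qed
            show "2 * (e - 1) < length (tl xs) + card (N - {y})"
              "Suc t + 2 * (e - 1) < 2 * s + length (tl xs)"
              using less.prems(7,12) cardN lens False ne by (cases xs; auto)+
            show "\<forall>S\<in>refine P (y, ?x) a. (if u \<noteq> 1 \<and> tl xs = [] then ?x else u) \<in> S \<or>
                (if u \<noteq> 1 \<and> tl xs = [] then y else v) \<in> S"
              using uv(3) acc by auto
            show "(if u \<noteq> 1 \<and> tl xs = [] then ?x else u) = 1 \<or> tl xs \<noteq> [] \<and> last (tl xs) = 1"
              using one ne by (cases xs) auto
          qed (use less.prems y x early in \<open>auto simp: distinct_tl\<close>)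
        qed
      qed
    qed
  qed
qed

text \<open>Until the first accusation the chain gains one person per question, hence
  \<open>t + 1 = length xs\<close>. With more than \<open>s\<close> members it must end in a knight,
  who is Person 1; the people outside it and its head remain to be checked.\<close>

lemma wins_chain:
  assumes "set xs \<subseteq> {1..n}" "distinct xs" "xs \<noteq> []" "last xs = 1"
    and "\<forall>S\<in>P. S \<subseteq> {1..n} \<and> card S \<le> s \<and> chain S xs"
    and "t + 1 = length xs" "t \<le> s" and "\<kappa> + 1 = 2 * s"
  shows "wins n met t P"
  using assms
proof (induction "n - length xs" arbitrary: xs t P rule: less_induct)
  case less
  note P = less.prems(5)
  have card_rest: "card ({1..n} - set xs) = n - length xs"
    using less.prems(1,2) by (simp add: card_Diff_subset distinct_card)
  show ?case
  proof (cases "s < length xs")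
    case True
    have knight: "\<forall>S\<in>P. 1 \<notin> S"
    proof (intro ballI notI)
      fix S assume S: "S \<in> P" "1 \<in> S"
      then have "set xs \<subseteq> S" using chain_last[of S xs] less.prems(3,4) P by auto
      moreover have "finite S" by (rule finite_subset[of _ "{1..n}"]) (use P S in auto)
      ultimately have "length xs \<le> card S"
        using card_mono distinct_card[OF less.prems(2)] by metis
      then show False using P S True by fastforce
    qed
    have g: "hd xs \<in> {1..n} - {1}"
      using hd_neq_last[of xs] True s_pos less.prems(1-4) hd_in_set[of xs]
      by (auto simp: subset_iff)
    obtain fs where fs: "set fs = {1..n} - set xs" "distinct fs"
      using finite_distinct_list[of "{1..n} - set xs"] by auto
    have len: "t + length fs < n"
      using fs distinct_card[of fs] card_rest less.prems(6,7) majority by simp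
    show ?thesis
    proof (rule wins_no_accusation[OF knight g _ _ len])
      show "set fs \<subseteq> {1..n} - {1}" using fs less.prems(3,4) last_in_set[of xs] by auto
      show "\<forall>S\<in>P. (\<forall>f\<in>set fs. f \<notin> S) \<longrightarrow> hd xs \<notin> S \<longrightarrow> S = {}"
        using fs chain_hd P by blast
    qed
  next
    case False
    then have "0 < card ({1..n} - set xs)" using card_rest majority by simp
    then have "{1..n} - set xs \<noteq> {}" by (metis card.empty less_irrefl)
    then obtain y where y: "y \<in> {1..n} - set xs" by blast
    let ?x = "hd xs"
    have x: "?x \<in> set xs" using less.prems(3) by simp
    have legal: "legal n (y, ?x)" using x y less.prems(1) by (auto simp: legal_def)
    have t: "t < s" using False less.prems(6) by simp
    show ?thesis
    proof (rule wins.ask[OF _ legal])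
      show "met t P" using t less.prems(8) majority s_pos by (intro met_early) auto
      fix a
      show "wins n met (Suc t) (refine P (y, ?x) a)"
      proof (cases a)
        case no: False
        have chain: "chain S (y # xs)" if "S \<in> refine P (y, ?x) a" for S
        proof -
          have "chain S ([y] @ xs)"
            using that no P by (intro chain_append) (auto simp: refine_def)
          then show ?thesis by simp
        qed
        show ?thesis
          by (rule less.hyps[of "y # xs"])
            (use less.prems y t chain False majority in \<open>auto simp: refine_def\<close>)
      next
        case yes: True
        have acc: "S \<in> refine P (y, ?x) a \<Longrightarrow> S \<in> P \<and> (y \<in> S \<or> ?x \<in> S)" for S
          using yes by (auto simp: refine_def)
        have tl: "set (tl xs) \<subseteq> set xs" "?x \<notin> set (tl xs)" "length (tl xs) + 1 = length xs"
          using less.prems(2,3) by (cases xs; auto)+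
        let ?N = "{1..n} - set xs - {y}"
        have cardN: "card ?N = n - length xs - 1" using y card_rest by simp
        show ?thesis
        proof (rule wins_chain_accused[of ?N "tl xs" _ "s - 1" ?x y])
          show "\<forall>S\<in>refine P (y, ?x) a. finite S \<and> chain S (tl xs) \<and>
              card (S \<inter> (set (tl xs) \<union> ?N)) \<le> s - 1"
          proof
            fix S assume "S \<in> refine P (y, ?x) a"
            then have S: "S \<in> P" "y \<in> S \<or> ?x \<in> S" using acc by auto
            have finS: "finite S" by (rule finite_subset[of _ "{1..n}"]) (use P S in auto)
            have "S \<inter> (set (tl xs) \<union> ?N) \<subset> S" using S(2) tl x y by blast
            then have "card (S \<inter> (set (tl xs) \<union> ?N)) < card S"
              using finS by (intro psubset_card_mono)
            moreover have "card S \<le> s" using P S by blast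
            ultimately have "card (S \<inter> (set (tl xs) \<union> ?N)) \<le> s - 1" by linarith
            then show "finite S \<and> chain S (tl xs) \<and> card (S \<inter> (set (tl xs) \<union> ?N)) \<le> s - 1"
              using finS P S chain_tl by blast
          qed
          show "2 * (s - 1) < length (tl xs) + card ?N"
            using cardN tl(3) False majority s_pos by linarith
          show "?x \<in> {1..n}" using x less.prems(1) by blast
          show "?x = 1 \<or> tl xs \<noteq> [] \<and> last (tl xs) = 1"
            using less.prems(3,4) by (cases xs) (auto split: if_splits)
          show "\<forall>S\<in>refine P (y, ?x) a. ?x \<in> S \<or> y \<in> S" using acc by blast
          show "Suc t + 2 * (s - 1) < 2 * s + length (tl xs)" "Suc t < 2 * s"
            using t tl(3) less.prems(6) by linarith+
        qed (use less.prems tl x y in \<open>auto simp: distinct_tl\<close>)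
      qed
    qed
  qed
qed

text \<open>Since \<open>2 * s < n\<close>, the slack required by \<open>wins_paths\<close> is
  missing only if \<open>binary_ones s = 1\<close>, and then \<open>\<kappa> + 1 = 2 * s\<close>, as
  \<open>wins_chain\<close> requires. Otherwise the first \<open>2 * s\<close> people start as
  singleton chains and the next one is the reserve.\<close>

lemma wins_start: "wins n met 0 {S. S \<subseteq> {1..n} \<and> card S \<le> s}"
proof (cases "2 * s + 2 < n + binary_ones s")
  case True
  show ?thesis
    by (rule wins_paths[of "{1..2 * s}" "\<lambda>c. [c]" "2 * s + 1"])
      (use True s_pos majority in \<open>auto intro: exI[of _ 0]\<close>)
next
  case False
  then have "binary_ones s = 1" using binary_ones_pos[OF s_pos] majority by linarith
  then have "\<kappa> + 1 = 2 * s" using \<kappa>_eq by simp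
  then show ?thesis
    using majority by (intro wins_chain[of "[1]"]) auto
qed

end

section \<open>From game trees to the stated deadlines\<close>

lemma card_knights: "S \<subseteq> {1..n} \<Longrightarrow> card ({1..n} - S) = n - card S"
  by (simp add: card_Diff_subset finite_subset)

lemma by_questionI:
  "(\<And>S \<beta>. goal (possible W (transcript \<sigma> S \<beta> t))) \<Longrightarrow> by_question W \<sigma> t goal"
  by (auto simp: by_question_def)

lemma strategy_exists:
  assumes k: "real n / 2 < real k" "k < n"
  shows "\<exists>\<sigma>. questioning_strategy n \<sigma> \<and>
    by_question (assignments n k) \<sigma> (K n k + 1) (knight_identified n) \<and>
    by_question (assignments n k) \<sigma> (K n k + 2) (identity_determined 1) \<and>
    by_question (assignments n k) \<sigma> n (\<lambda>P. spy_identified n P \<or> all_knights_proved P) \<and>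
    by_question (assignments_with_spy n k) \<sigma> (n - 1) (spy_identified n)"
proof -
  have "2 * (n - k) < n" using k by linarith
  then interpret room n "n - k" using k by unfold_locales auto
  have \<kappa>: "\<kappa> = K n k" by (simp add: \<kappa>_def K_def)
  have W: "assignments n k = {S. S \<subseteq> {1..n} \<and> card S \<le> n - k}"
  proof -
    have "k \<le> card ({1..n} - S) \<longleftrightarrow> card S \<le> n - k" if "S \<subseteq> {1..n}" for S
      using k card_mono[OF _ that] card_knights[OF that] by auto
    then show ?thesis unfolding assignments_def by blast
  qed
  obtain \<sigma> where \<sigma>: "questioning_strategy n \<sigma>"
    "\<And>S \<beta> m. met m (possible (assignments n k) (transcript \<sigma> S \<beta> m))"
    using wins_strategy[of n met "assignments n k"] wins_start majority s_pos W by auto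
  \<comment> \<open>Excluding \<open>{}\<close> commutes with gaining knowledge, so one strategy
    serves with and without the promise of a spy.\<close>
  have W': "possible (assignments_with_spy n k) h = possible (assignments n k) h - {{}}" for h
    by (auto simp: possible_def assignments_with_spy_def)
  have "by_question (assignments n k) \<sigma> (K n k + 1) (knight_identified n)"
    "by_question (assignments n k) \<sigma> (K n k + 2) (identity_determined 1)"
    "by_question (assignments n k) \<sigma> n (\<lambda>P. spy_identified n P \<or> all_knights_proved P)"
    "by_question (assignments_with_spy n k) \<sigma> (n - 1) (spy_identified n)"
    using \<sigma>(2)[of "K n k + 1"] \<sigma>(2)[of "K n k + 2"] \<sigma>(2)[of n] \<sigma>(2)[of "n - 1"] majority
    unfolding met_def \<kappa> W'[symmetric] by (simp_all add: by_questionI)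
  then show ?thesis using \<sigma>(1) by blast
qed

section \<open>Adversaries\<close>

text \<open>\<open>goal\<close> is tested only after the last question; for goals that persist under
  further answers this excludes earlier success too.\<close>

primrec avoids :: "nat \<Rightarrow> nat \<Rightarrow> (nat set set \<Rightarrow> bool) \<Rightarrow> nat set set \<Rightarrow> bool" where
  "avoids n 0 goal P = (\<not> goal P)"
| "avoids n (Suc j) goal P = (\<forall>q. legal n q \<longrightarrow> (\<exists>a. avoids n j goal (refine P q a)))"

definition asked :: "strategy \<Rightarrow> history \<Rightarrow> bool" where
  "asked \<sigma> h \<longleftrightarrow> (\<forall>i<length h. fst (h ! i) = \<sigma> (take i h))"

lemma asked_Nil [simp]: "asked \<sigma> []"
  by (simp add: asked_def)

lemma asked_snoc: "asked \<sigma> h \<Longrightarrow> asked \<sigma> (h @ [(\<sigma> h, a)])"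
  by (auto simp: asked_def nth_append less_Suc_eq)

lemma avoids_history:
  assumes "questioning_strategy n \<sigma>"
  shows "asked \<sigma> h \<Longrightarrow> avoids n j goal (possible W h) \<Longrightarrow>
    \<exists>h'. asked \<sigma> h' \<and> length h' = length h + j \<and> \<not> goal (possible W h')"
proof (induction j arbitrary: h)
  case 0
  then show ?case by auto
next
  case (Suc j)
  have "legal n (\<sigma> h)" using assms by (simp add: questioning_strategy_legal)
  then obtain a where "avoids n j goal (possible W (h @ [(\<sigma> h, a)]))"
    using Suc.prems(2) unfolding possible_snoc avoids.simps by blast
  then show ?case using Suc.IH[OF asked_snoc[OF Suc.prems(1), of a]] by simp
qed

text \<open>The adversary commits to \<open>S\<close> only afterwards: \<open>\<beta>\<close>
  replays the answers recorded in \<open>h\<close>, and those of knights are truthful because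
  \<open>S\<close> is still possible.\<close>

lemma transcript_asked:
  assumes h: "asked \<sigma> h" and S: "S \<in> possible W h"
  shows "\<exists>\<beta>. \<forall>m\<le>length h. transcript \<sigma> S \<beta> m = take m h"
proof -
  define \<beta> :: behaviour where "\<beta> g q = snd (h ! length g)" for g q
  have "m \<le> length h \<longrightarrow> transcript \<sigma> S \<beta> m = take m h" for m
  proof (induction m)
    case (Suc m)
    show ?case
    proof
      assume m: "Suc m \<le> length h"
      obtain x y a where hm: "h ! m = ((x, y), a)" by (metis surj_pair)
      then have "((x, y), a) \<in> set h" using m by (metis Suc_le_lessD nth_mem)
      then have "x \<notin> S \<longrightarrow> (a \<longleftrightarrow> y \<in> S)" using S by (auto simp: possible_def)
      then have "answer S \<beta> (take m h) (x, y) = a" using m hm by (auto simp: \<beta>_def)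
      moreover have "\<sigma> (take m h) = (x, y)" using h m hm unfolding asked_def by (metis Suc_le_lessD fst_conv)
      ultimately show "transcript \<sigma> S \<beta> (Suc m) = take (Suc m) h"
        using Suc m hm by (simp add: Let_def take_Suc_conv_app_nth)
    qed
  qed simp
  then show ?thesis by blast
qed

text \<open>As \<open>goal {}\<close> holds, failure leaves some possible \<open>S\<close>, which
  realises the bad history. Monotonicity rules out success at any earlier moment of it.\<close>

lemma avoids_by_question:
  assumes \<sigma>: "questioning_strategy n \<sigma>" and h: "asked \<sigma> h"
    and avoid: "avoids n j goal (possible W h)"
    and mono: "\<And>P P'. goal P \<Longrightarrow> P' \<subseteq> P \<Longrightarrow> goal P'" and empty: "goal {}"
  shows "\<not> by_question W \<sigma> (length h + j) goal"
proof
  assume by_q: "by_question W \<sigma> (length h + j) goal"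
  obtain h' where h': "asked \<sigma> h'" "length h' = length h + j" "\<not> goal (possible W h')"
    using avoids_history[OF \<sigma> h avoid] by blast
  then obtain S where S: "S \<in> possible W h'" using empty by fastforce
  then obtain \<beta> where \<beta>: "\<forall>m\<le>length h'. transcript \<sigma> S \<beta> m = take m h'"
    using transcript_asked h' by blast
  have "S \<in> W" using S by (simp add: possible_def)
  then obtain m where m: "m \<le> length h'" "goal (possible W (take m h'))"
    using by_q \<beta> h' unfolding by_question_def by metis
  have "possible W h' \<subseteq> possible W (take m h')"
    using possible_append_subset[of W "take m h'" "drop m h'"] by simp
  then show False using mono m h' by blast
qed

text \<open>The adversary keeps open that the spies are \<open>{1..n} - D\<close>, and also that they are any three
  members of \<open>D\<close> including \<open>M\<close>. A question put to a member of \<open>{1..n} - D\<close> about a member \<open>y\<close> of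
  \<open>D\<close>, or put to a member \<open>y\<close> of \<open>D\<close>, then costs only the triples that omit \<open>y\<close>.\<close>

lemma avoids_knight:
  assumes "D \<subseteq> {1..n}" "3 \<le> card D" "{1..n} - D \<in> P" "M \<subseteq> D"
    and "\<And>S. M \<subseteq> S \<Longrightarrow> S \<subseteq> D \<Longrightarrow> card S = 3 \<Longrightarrow> S \<in> P"
    and "card M + j \<le> 2"
  shows "avoids n j (knight_identified n) P"
  using assms
proof (induction j arbitrary: M P)
  case 0
  have fin: "finite D" by (rule finite_subset[OF 0(1)]) simp
  have "\<exists>S\<in>P. p \<in> S" if p: "p \<in> {1..n}" for p
  proof (cases "p \<in> D")
    case True
    have "card (insert p M) \<le> 3" using 0 card_insert_le_m1[of 3 M p] by simp
    moreover have "insert p M \<subseteq> D" using True 0 by simp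
    ultimately obtain S where "insert p M \<subseteq> S" "S \<subseteq> D" "card S = 3"
      using exists_subset_between[of "insert p M" 3 D] fin 0 by blast
    then have "S \<in> P" using 0 by simp
    then show ?thesis using \<open>insert p M \<subseteq> S\<close> by blast
  next
    case False
    then have "p \<in> {1..n} - D" using p by simp
    then show ?thesis using 0(3) by blast
  qed
  then show ?case by (auto simp: knight_identified_def)
next
  case (Suc j)
  have "\<exists>a. avoids n j (knight_identified n) (refine P (x, y) a)"
    if q: "x \<in> {1..n}" "y \<in> {1..n}" for x y
  proof -
    \<comment> \<open>For \<open>x\<close> in \<open>D\<close> the answer is true for the spies
      \<open>{1..n} - D\<close>, and \<open>x\<close> joins the triples as a spy. For
      \<open>x\<close> outside \<open>D\<close> it is true for the triples, once they contain
      \<open>y\<close> if \<open>y\<close> is in \<open>D\<close>, while \<open>x\<close> is a spy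
      in \<open>{1..n} - D\<close>.\<close>
    define M' where "M' = (if x \<in> D then insert x M else if y \<in> D then insert y M else M)"
    define a where "a \<longleftrightarrow> (if x \<in> D then y \<notin> D else y \<in> D)"
    have fin: "finite M"
      by (rule finite_subset[of M "{1..n}"]) (use Suc.prems(1,4) in auto)
    have "avoids n j (knight_identified n) (refine P (x, y) a)"
    proof (rule Suc.IH[of _ M'])
      show "{1..n} - D \<in> refine P (x, y) a"
        using Suc.prems(3) q by (auto simp: refine_def a_def)
      show "M' \<subseteq> D" using Suc.prems(4) by (auto simp: M'_def)
      show "S \<in> refine P (x, y) a" if "M' \<subseteq> S" "S \<subseteq> D" "card S = 3" for S
        using Suc.prems(5)[of S] that by (auto simp: refine_def a_def M'_def split: if_splits)
      have "card M' \<le> Suc (card M)"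
        using fin by (auto simp: M'_def card_insert_if)
      then show "card M' + j \<le> 2" using Suc.prems(6) by simp
    qed (use Suc.prems in auto)
    then show ?thesis by blast
  qed
  then show ?case by (auto simp: legal_def)
qed

text \<open>Answering "no" throughout eliminates at most the single-spy assignment of the person
  asked about. Two surviving singletons have no spy in common.\<close>

lemma avoids_spy:
  assumes "V \<subseteq> {1..n}" "\<forall>v\<in>V. {v} \<in> P" "j + 2 \<le> card V"
  shows "avoids n j (spy_identified n) P"
  using assms
proof (induction j arbitrary: V P)
  case 0
  have "\<exists>S\<in>P. x \<notin> S" for x
  proof -
    have "\<not> V \<subseteq> {x}" using 0 card_mono[of "{x}" V] by auto
    then obtain v where "v \<in> V" "v \<noteq> x" by blast
    then show ?thesis using 0(2) by (intro bexI[of _ "{v}"]) auto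
  qed
  then show ?case by (auto simp: spy_identified_def)
next
  case (Suc j)
  have "avoids n j (spy_identified n) (refine P (x, y) False)" for x y
  proof (rule Suc.IH[of "V - {y}"])
    have "card V \<le> Suc (card (V - {y}))"
      by (cases "y \<in> V") auto
    then show "j + 2 \<le> card (V - {y})" using Suc.prems(3) by simp
  qed (use Suc.prems in \<open>auto simp: refine_def\<close>)
  then show ?case by auto
qed

subsection \<open>Seven people, at least four knights\<close>

lemma assignments_7_4:
  "S \<in> assignments_with_spy 7 4 \<longleftrightarrow> S \<subseteq> {1..7} \<and> card S \<le> 3 \<and> S \<noteq> {}"
proof -
  have "4 \<le> card ({1..7} - S) \<longleftrightarrow> card S \<le> 3" if "S \<subseteq> {1..7}"
    using that card_mono[OF _ that] by (simp add: card_Diff_subset finite_subset) linarith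
  then show ?thesis unfolding assignments_with_spy_def assignments_def by blast
qed

lemma card_rest_7: "X \<subseteq> {1..7} \<Longrightarrow> card ({1..7::nat} - X) = 7 - card X"
  by (simp add: card_Diff_subset finite_subset)

text \<open>The spies may be \<open>a\<close>, \<open>b\<close>, \<open>z\<close>, or any three of
  the other four people including \<open>c\<close>. Forcing \<open>c\<close> respects the answer
  about \<open>d\<close> and makes "yes" about \<open>c\<close> true; one more question is still
  survivable.\<close>

lemma avoids_knight_two_pairs:
  assumes abcd: "distinct [a, b, c, d]" "{a, b, c, d} \<subseteq> {1..7}"
    and P: "\<And>S. S \<in> assignments_with_spy 7 4 \<Longrightarrow> b \<in> S \<longrightarrow> a \<in> S \<Longrightarrow> d \<in> S \<longrightarrow> c \<in> S \<Longrightarrow> S \<in> P"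
    and xy: "x \<in> {a, b, z} \<and> y \<in> {a, b, z} \<and> \<not> ans \<or> x \<in> {a, b, z} \<and> y = c \<and> ans"
    and z: "z \<in> {1..7}" "z \<notin> {a, b, c, d}"
  shows "avoids 7 1 (knight_identified 7) (refine P (x, y) ans)"
proof (rule avoids_knight[where D = "{1..7} - {a, b, z}" and M = "{c}"])
  have "card {a, b, z} = 3" using abcd z by auto
  then show "3 \<le> card ({1..7} - {a, b, z})" using abcd z by (subst card_rest_7) auto
  have T: "{1..7} - ({1..7} - {a, b, z}) = {a, b, z}" using abcd z by auto
  have "{a, b, z} \<in> P"
    using abcd z by (intro P) (auto simp: assignments_7_4)
  then show "{1..7} - ({1..7} - {a, b, z}) \<in> refine P (x, y) ans"
    unfolding T using xy by (auto simp: refine_def)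
  show "S \<in> refine P (x, y) ans"
    if S: "{c} \<subseteq> S" "S \<subseteq> {1..7} - {a, b, z}" "card S = 3" for S
  proof -
    have "S \<in> P" using S abcd z by (intro P) (auto simp: assignments_7_4)
    then show ?thesis using S xy by (auto simp: refine_def)
  qed
qed (use abcd z in auto)

lemma avoids_knight_three_pairs:
  assumes dist: "distinct [a, b, c, d, e, f]" "{a, b, c, d, e, f} \<subseteq> {1..7}"
    and P: "\<And>S. S \<in> assignments_with_spy 7 4 \<Longrightarrow> b \<in> S \<longrightarrow> a \<in> S \<Longrightarrow> d \<in> S \<longrightarrow> c \<in> S \<Longrightarrow>
      f \<in> S \<longrightarrow> e \<in> S \<Longrightarrow> S \<in> P"
    and y: "y \<in> {1..7}" "y \<notin> {b, d, f}"
  shows "avoids 7 0 (knight_identified 7) (refine P (x, y) True)"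
proof -
  have "\<exists>S\<in>refine P (x, y) True. p \<in> S" if p: "p \<in> {1..7}" for p
  proof -
    \<comment> \<open>Including \<open>y\<close> makes the accusation true, and the last entry is
      whoever vouched for \<open>p\<close>, or \<open>p\<close> again. Nobody vouched for
      \<open>y\<close>.\<close>
    define S where "S = {p, y, if p = b then a else if p = d then c else if p = f then e else p}"
    have "S \<in> P"
    proof (rule P)
      have "card S \<le> 3" unfolding S_def by (auto simp: card_insert_if)
      then show "S \<in> assignments_with_spy 7 4"
        unfolding assignments_7_4 using dist p y by (auto simp: S_def)
    qed (use dist y in \<open>auto simp: S_def\<close>)
    then have "S \<in> refine P (x, y) True" "p \<in> S" by (auto simp: refine_def S_def)
    then show ?thesis by blast
  qed
  then show ?thesis by (auto simp: knight_identified_def)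
qed

lemma no_strategy_7_4:
  assumes \<sigma>: "questioning_strategy 7 \<sigma>"
    and knight: "by_question (assignments_with_spy 7 4) \<sigma> 4 (knight_identified 7)"
    and spy: "by_question (assignments_with_spy 7 4) \<sigma> 6 (spy_identified 7)"
  shows False
proof -
  let ?W = "assignments_with_spy 7 4"
  have no_knight: False
    if "asked \<sigma> h" "avoids 7 j (knight_identified 7) (possible ?W h)" "length h + j = 4" for h j
  proof -
    have "knight_identified 7 {}" by (auto simp: knight_identified_def intro: exI[of _ 1])
    then have "\<not> by_question ?W \<sigma> (length h + j) (knight_identified 7)"
      using \<sigma> that(1,2) knight_identified_mono by (intro avoids_by_question) auto
    then show False using that(3) knight by simp
  qed
  have no_spy: False
    if "asked \<sigma> h" "avoids 7 j (spy_identified 7) (possible ?W h)" "length h + j = 6" for h j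
  proof -
    have "spy_identified 7 {}" by (auto simp: spy_identified_def intro: exI[of _ 1])
    then have "\<not> by_question ?W \<sigma> (length h + j) (spy_identified 7)"
      using \<sigma> that(1,2) spy_identified_mono by (intro avoids_by_question) auto
    then show False using that(3) spy by simp
  qed
  have range: "\<sigma> h = (x, y) \<Longrightarrow> x \<in> {1..7} \<and> y \<in> {1..7} \<and> x \<noteq> y" for h x y
    using \<sigma> unfolding questioning_strategy_legal legal_def by (metis fst_conv snd_conv)
  have ask: "asked \<sigma> (h @ [(q, ans)])" if "asked \<sigma> h" "\<sigma> h = q" for h q ans
    using asked_snoc[OF that(1)] that(2) by simp
  have singletons: "{v} \<in> ?W" if "v \<in> {1..7}" for v
    using that by (simp add: assignments_7_4)

  obtain a b where ab: "\<sigma> [] = (a, b)" by fastforce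
  define h1 where "h1 = [((a, b), False)]"
  have h1: "asked \<sigma> h1" using ask[OF asked_Nil ab] by (simp add: h1_def)
  obtain c d where cd: "\<sigma> h1 = (c, d)" by fastforce
  define h2 where "h2 = h1 @ [((c, d), False)]"
  have h2: "asked \<sigma> h2" "length h2 = 2" using ask[OF h1 cd] by (auto simp: h2_def h1_def)
  have P2: "S \<in> possible ?W h2 \<longleftrightarrow> S \<in> ?W \<and> (b \<in> S \<longrightarrow> a \<in> S) \<and> (d \<in> S \<longrightarrow> c \<in> S)" for S
    by (auto simp: h2_def h1_def possible_def)
  have in7: "{a, b, c, d} \<subseteq> {1..7}" using range[OF ab] range[OF cd] by auto
  show False
  proof (cases "card {a, b, c, d} \<le> 3")
    case True
    \<comment> \<open>\<open>T\<close> contains everyone involved so far. The four others are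
      untouched, so \<open>M\<close> starts empty and two more questions are survivable.\<close>
    obtain T where T: "{a, b, c, d} \<subseteq> T" "T \<subseteq> {1..7}" "card T = 3"
      using exists_subset_between[OF True _ in7] by auto
    have "avoids 7 2 (knight_identified 7) (possible ?W h2)"
    proof (rule avoids_knight[where D = "{1..7} - T" and M = "{}"])
      show "3 \<le> card ({1..7} - T)" using T by (subst card_rest_7) auto
      have "{1..7} - ({1..7} - T) = T" using T by auto
      then show "{1..7} - ({1..7} - T) \<in> possible ?W h2"
        using T by (auto simp: P2 assignments_7_4)
      show "S \<in> possible ?W h2" if "{} \<subseteq> S" "S \<subseteq> {1..7} - T" "card S = 3" for S
        using that T by (auto simp: P2 assignments_7_4)
    qed auto
    then show False using no_knight h2 by fastforce
  next
    case False
    then have dist: "distinct [a, b, c, d]"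
      by (auto simp: card_insert_if split: if_splits)
    obtain x y where xy: "\<sigma> h2 = (x, y)" by fastforce
    have h3: "asked \<sigma> (h2 @ [((x, y), ans)])" "length (h2 @ [((x, y), ans)]) = 3" for ans
      using ask[OF h2(1) xy] h2 by auto
    let ?P = "\<lambda>ans. refine (possible ?W h2) (x, y) ans"
    have spy3: "\<not> avoids 7 3 (spy_identified 7) (?P ans)" for ans
      using no_spy[OF h3(1), of 3 ans] h3(2) by (auto simp: possible_snoc)
    have knight3: "\<not> avoids 7 1 (knight_identified 7) (?P ans)" for ans
      using no_knight[OF h3(1), of 1 ans] h3(2) by (auto simp: possible_snoc)
    have pairs: False
      if "x \<in> {a, b, z} \<and> y \<in> {a, b, z} \<or> x \<in> {a, b, z} \<and> y = c"
        "z \<in> {1..7}" "z \<notin> {a, b, c, d}" for z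
    proof -
      have "avoids 7 1 (knight_identified 7) (?P (y = c))"
        by (rule avoids_knight_two_pairs[OF dist in7, where z = z]) (use that dist in \<open>auto simp: P2\<close>)
      then show False using knight3 by blast
    qed
    have pairs': False
      if "x \<in> {c, d, z} \<and> y \<in> {c, d, z} \<or> x \<in> {c, d, z} \<and> y = a"
        "z \<in> {1..7}" "z \<notin> {a, b, c, d}" for z
    proof -
      have "avoids 7 1 (knight_identified 7) (?P (y = a))"
        by (rule avoids_knight_two_pairs[of c d a b, where z = z])
          (use that dist in7 in \<open>auto simp: P2\<close>)
      then show False using knight3 by blast
    qed
    have "card ({1..7} - {a, b, c, d}) = 3"
      using card_rest_7[OF in7] dist by simp
    then obtain z where z: "z \<in> {1..7}" "z \<notin> {a, b, c, d}"
      by (metis DiffE card.empty ex_in_conv zero_neq_numeral)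
    \<comment> \<open>After "no" to a third question about \<open>b\<close> or \<open>d\<close>,
      five single-spy assignments survive with three questions left, one too many.\<close>
    have y: "y \<notin> {b, d}"
    proof
      assume y: "y \<in> {b, d}"
      have "avoids 7 3 (spy_identified 7) (?P False)"
      proof (rule avoids_spy[where V = "{1..7} - {b, d}"])
        show "3 + 2 \<le> card ({1..7} - {b, d})"
          using in7 dist by (subst card_rest_7) auto
        show "\<forall>v\<in>{1..7} - {b, d}. {v} \<in> ?P False"
          using y singletons by (auto simp: refine_def P2)
      qed auto
      then show False using spy3 by blast
    qed
    have xy7: "x \<in> {1..7}" "y \<in> {1..7}" "x \<noteq> y" using range[OF xy] by auto
    \<comment> \<open>If \<open>x\<close> or \<open>y\<close> belonged to the first two pairs,
      \<open>pairs\<close> or \<open>pairs'\<close> would apply, the third spy being whichever of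
      \<open>x\<close>, \<open>y\<close> lies outside, or else \<open>z\<close>.\<close>
    have out: "x \<notin> {a, b, c, d}" "y \<notin> {a, b, c, d}"
      using pairs[of z] pairs'[of z] pairs[of x] pairs'[of x] pairs[of y] pairs'[of y] y z xy7
      by auto
    define h3 where "h3 = h2 @ [((x, y), False)]"
    obtain u v where uv: "\<sigma> h3 = (u, v)" by fastforce
    have h4: "asked \<sigma> (h3 @ [((u, v), ans)])" "length (h3 @ [((u, v), ans)]) = 4" for ans
      using ask[of h3 "(u, v)" ans] h3[of False] uv by (auto simp: h3_def)
    have P3: "S \<in> possible ?W h3 \<longleftrightarrow> S \<in> ?W \<and> (b \<in> S \<longrightarrow> a \<in> S) \<and> (d \<in> S \<longrightarrow> c \<in> S) \<and>
        (y \<in> S \<longrightarrow> x \<in> S)" for S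
      by (auto simp: h3_def possible_snoc refine_def P2)
    have uv7: "v \<in> {1..7}" using range[OF uv] by auto
    have dist3: "distinct [a, b, c, d, x, y]" using dist out xy7 by auto
    show False
    proof (cases "v \<in> {b, d, y}")
      case True
      have "avoids 7 2 (spy_identified 7) (refine (possible ?W h3) (u, v) False)"
      proof (rule avoids_spy[where V = "{1..7} - {b, d, y}"])
        show "2 + 2 \<le> card ({1..7} - {b, d, y})"
          using in7 dist3 xy7 by (subst card_rest_7) auto
        show "\<forall>w\<in>{1..7} - {b, d, y}. {w} \<in> refine (possible ?W h3) (u, v) False"
          using True singletons by (auto simp: refine_def P3)
      qed auto
      then show False using no_spy[OF h4(1), of 2 False] h4(2) by (auto simp: possible_snoc)
    next
      case False
      have "avoids 7 0 (knight_identified 7) (refine (possible ?W h3) (u, v) True)"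
        by (rule avoids_knight_three_pairs[OF dist3]) (use in7 xy7 uv7 False P3 in auto)
      then show False using no_knight[OF h4(1), of 0 True] h4(2) by (auto simp: possible_snoc)
    qed
  qed
qed

lemma K_7_4: "K 7 4 = 4"
  by (simp add: K_def binary_ones_rec[of 3] binary_ones_rec[of "Suc 0"])

theorem theorem5:
  shows "(\<forall>n k :: nat. real n / 2 < real k \<and> k < n \<longrightarrow>
            (\<exists>\<sigma>. questioning_strategy n \<sigma> \<and>
                 by_question (assignments n k) \<sigma> (K n k + 1) (knight_identified n) \<and>
                 by_question (assignments n k) \<sigma> (K n k + 2) (identity_determined 1) \<and>
                 by_question (assignments n k) \<sigma> n
                   (\<lambda>P. spy_identified n P \<or> all_knights_proved P) \<and>
                 by_question (assignments_with_spy n k) \<sigma> (n - 1) (spy_identified n)))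
       \<and> K 7 4 = 4
       \<and> \<not> (\<exists>\<sigma>. questioning_strategy 7 \<sigma> \<and>
                 by_question (assignments_with_spy 7 4) \<sigma> (K 7 4) (knight_identified 7) \<and>
                 by_question (assignments_with_spy 7 4) \<sigma> 6 (spy_identified 7))"
  using strategy_exists K_7_4 no_strategy_7_4 by auto

end
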